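(* Let $A$ be a finite skew left brace, let $\phi$ be the regular representation (over $\mathbb{C}$) of the group $\Lambda_{A^{\mathrm{op}}}$, and let $\beta_\phi$ and $\rho_\phi$ be the representations of $(A,\cdot)$ and $(A,\circ)$ given by $\beta_\phi(a)=\phi(a,1)$ and $\rho_\phi(b)=\phi(1,b)$ for $a,b\in A$. Let $\beta_{reg}$ and $\rho_{reg}$ be the regular representations of $(A,\cdot)$ and $(A,\circ)$, respectively. Then $$\beta_\phi=|A|\cdot\beta_{reg}\quad\text{and}\quad \rho_\phi=|A|\cdot\rho_{reg},$$ that is, as representations up to equivalence, $\beta_\phi$ is a direct sum of $|A|$ copies of $\beta_{reg}$ and $\rho_\phi$ is a direct sum of $|A|$ copies of $\rho_{reg}$.
   Context: A skew left brace is a triple $(A,\cdot,\circ)$ where $(A,\cdot)$ and $(A,\circ)$ are groups with $a\circ(b\cdot c)=(a\circ b)\cdot a^{-1}\cdot(a\circ c)$ for all $a,b,c\in A$, where $a^{-1}$ is the inverse in $(A,\cdot)$. We write $ab=a\cdot b$; the two groups share the identity $1$. The map $\lambda^{\mathrm{op}}:(A,\circ)\to\mathrm{Aut}(A,\cdot)$, $\lambda^{\mathrm{op}}_a(b)=(a\circ b)a^{-1}$, is a group homomorphism. The group $\Lambda_{A^{\mathrm{op}}}=(A,\cdot)\rtimes_{\lambda^{\mathrm{op}}}(A,\circ)$ is the set $A\times A$ with product $(a_1,b_1)(a_2,b_2)=(a_1\lambda^{\mathrm{op}}_{b_1}(a_2),\,b_1\circ b_2)$. The regular representation of a finite group $G$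 is its action by left multiplication on the group algebra $\mathbb{C}G$. *)

theory Defs
  imports Complex_Main "HOL-Algebra.Algebra" "HOL-Algebra.Algebraic_Closure_Type"
begin

section \<open>Skew left braces\<close>

text \<open>The two group structures are HOL-Algebra groups \<open>A\<close> (the operation written as a dot or by
  juxtaposition) and \<open>C\<close> (the operation written as a circle) with the same carrier.\<close>

locale skew_left_brace = dot: group A + circ: group C
  for A :: "'a monoid" (structure) and C :: "'a monoid" +
  assumes same_carrier: "carrier C = carrier A"
    and brace_distrib:
      "\<lbrakk>a \<in> carrier A; b \<in> carrier A; c \<in> carrier A\<rbrakk> \<Longrightarrow>
        a \<otimes>\<^bsub>C\<^esub> (b \<otimes>\<^bsub>A\<^esub> c) = (a \<otimes>\<^bsub>C\<^esub> b) \<otimes>\<^bsub>A\<^esub> inv\<^bsub>A\<^esub> a \<otimes>\<^bsub>A\<^esub> (a \<otimes>\<^bsub>C\<^esub> c)"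

definition lambda_op :: "'a monoid \<Rightarrow> 'a monoid \<Rightarrow> 'a \<Rightarrow> 'a \<Rightarrow> 'a"
  where "lambda_op A C a b = (a \<otimes>\<^bsub>C\<^esub> b) \<otimes>\<^bsub>A\<^esub> inv\<^bsub>A\<^esub> a"

definition semidirect_product :: "'a monoid \<Rightarrow> 'b monoid \<Rightarrow> ('b \<Rightarrow> 'a \<Rightarrow> 'a) \<Rightarrow> ('a \<times> 'b) monoid"
  where "semidirect_product N H \<sigma> =
    \<lparr>carrier = carrier N \<times> carrier H,
     monoid.mult = (\<lambda>(a1, b1) (a2, b2). (a1 \<otimes>\<^bsub>N\<^esub> \<sigma> b1 a2, b1 \<otimes>\<^bsub>H\<^esub> b2)),
     one = (\<one>\<^bsub>N\<^esub>, \<one>\<^bsub>H\<^esub>)\<rparr>"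

definition Lambda_op :: "'a monoid \<Rightarrow> 'a monoid \<Rightarrow> ('a \<times> 'a) monoid"
  where "Lambda_op A C = semidirect_product A C (lambda_op A C)"

section \<open>Complex representations\<close>

abbreviation complex_field :: "complex ring" (\<open>\<complex>\<^sub>F\<close>)
  where "\<complex>\<^sub>F \<equiv> ring_of_type_algebra"

text \<open>Vector spaces are modules over \<open>\<complex>\<^sub>F\<close>. Only \<open>carrier\<close>, \<open>add\<close>, \<open>zero\<close> and \<open>smult\<close> of the
  module record are constrained by \<^locale>\<open>Module.module\<close>.\<close>

definition linear_maps ::
    "(complex, 'v) module \<Rightarrow> (complex, 'w) module \<Rightarrow> ('v \<Rightarrow> 'w) set"
  where "linear_maps V W =
    {T \<in> carrier V \<rightarrow> carrier W.
      (\<forall>x\<in>carrier V. \<forall>y\<in>carrier V. T (x \<oplus>\<^bsub>V\<^esub> y) = T x \<oplus>\<^bsub>W\<^esub> T y) \<and>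
      (\<forall>c. \<forall>x\<in>carrier V. T (c \<odot>\<^bsub>V\<^esub> x) = c \<odot>\<^bsub>W\<^esub> T x)}"

locale representation = V: Module.module "\<complex>\<^sub>F" V + group_action G "carrier V" \<phi>
  for G :: "'g monoid" and V :: "(complex, 'v) module" and \<phi> :: "'g \<Rightarrow> 'v \<Rightarrow> 'v" +
  assumes linear: "g \<in> carrier G \<Longrightarrow> \<phi> g \<in> linear_maps V V"

text \<open>Equivalence includes the assertion that both sides are representations of \<open>G\<close>.\<close>

definition equivalent_representations ::
    "'g monoid \<Rightarrow> (complex, 'v) module \<Rightarrow> ('g \<Rightarrow> 'v \<Rightarrow> 'v) \<Rightarrow>
      (complex, 'w) module \<Rightarrow> ('g \<Rightarrow> 'w \<Rightarrow> 'w) \<Rightarrow> bool"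
  where "equivalent_representations G V \<phi> W \<psi> \<longleftrightarrow>
    representation G V \<phi> \<and> representation G W \<psi> \<and>
    (\<exists>T \<in> linear_maps V W. bij_betw T (carrier V) (carrier W) \<and>
      (\<forall>g\<in>carrier G. \<forall>v\<in>carrier V. T (\<phi> g v) = \<psi> g (T v)))"

text \<open>The direct sum of \<open>n\<close> copies of \<open>V\<close> consists of the families indexed by \<open>{..<n}\<close>.\<close>

definition copies_space :: "nat \<Rightarrow> (complex, 'v) module \<Rightarrow> (complex, nat \<Rightarrow> 'v) module"
  where "copies_space n V =
    \<lparr>carrier = {..<n} \<rightarrow>\<^sub>E carrier V,
     monoid.mult = (\<lambda>f h. \<lambda>i\<in>{..<n}. f i \<otimes>\<^bsub>V\<^esub> h i),
     one = (\<lambda>i\<in>{..<n}. \<one>\<^bsub>V\<^esub>),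
     ring.zero = (\<lambda>i\<in>{..<n}. \<zero>\<^bsub>V\<^esub>),
     ring.add = (\<lambda>f h. \<lambda>i\<in>{..<n}. f i \<oplus>\<^bsub>V\<^esub> h i),
     module.smult = (\<lambda>c f. \<lambda>i\<in>{..<n}. c \<odot>\<^bsub>V\<^esub> f i)\<rparr>"

definition copies_action ::
    "nat \<Rightarrow> (complex, 'v) module \<Rightarrow> ('g \<Rightarrow> 'v \<Rightarrow> 'v) \<Rightarrow> 'g \<Rightarrow> (nat \<Rightarrow> 'v) \<Rightarrow> (nat \<Rightarrow> 'v)"
  where "copies_action n V \<phi> g = (\<lambda>f\<in>carrier (copies_space n V). \<lambda>i\<in>{..<n}. \<phi> g (f i))"

section \<open>The regular representation\<close>

text \<open>A formal sum of elements of the group is encoded as its coefficient function, and the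
  product is convolution. This is the group algebra for finite \<open>G\<close> only: there is no finite support
  condition.\<close>

definition group_elem :: "'g monoid \<Rightarrow> 'g \<Rightarrow> 'g \<Rightarrow> complex"
  where "group_elem G g = (\<lambda>x\<in>carrier G. if x = g then 1 else 0)"

definition group_algebra :: "'g monoid \<Rightarrow> (complex, 'g \<Rightarrow> complex) module"
  where "group_algebra G =
    \<lparr>carrier = carrier G \<rightarrow>\<^sub>E UNIV,
     monoid.mult = (\<lambda>f h. \<lambda>x\<in>carrier G. \<Sum>y\<in>carrier G. f y * h (inv\<^bsub>G\<^esub> y \<otimes>\<^bsub>G\<^esub> x)),
     one = group_elem G \<one>\<^bsub>G\<^esub>,
     ring.zero = (\<lambda>x\<in>carrier G. 0),
     ring.add = (\<lambda>f h. \<lambda>x\<in>carrier G. f x + h x),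
     module.smult = (\<lambda>c f. \<lambda>x\<in>carrier G. c * f x)\<rparr>"

definition regular_rep :: "'g monoid \<Rightarrow> 'g \<Rightarrow> ('g \<Rightarrow> complex) \<Rightarrow> ('g \<Rightarrow> complex)"
  where "regular_rep G g =
    (\<lambda>v\<in>carrier (group_algebra G). group_elem G g \<otimes>\<^bsub>group_algebra G\<^esub> v)"

end

theory Submission
  imports Defs
begin

text \<open>Restricted to a subgroup \<open>H\<close>, the regular representation of a finite group \<open>L\<close> splits along the
  right cosets of \<open>H\<close> into \<open>|L| / |H|\<close> copies of the regular representation of \<open>H\<close>. In
  \<open>\<Lambda>\<close> the images of the two groups are transversals of each other: \<open>(a, 1)(1, b) = (a, b)\<close> and
  \<open>(1, b)(a, 1) = (\<lambda>\<^sub>b(a), b)\<close>, where \<open>\<lambda>\<^sub>b\<close> is a bijection.\<close>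

section \<open>Representations\<close>

text \<open>Bijectivity of each \<open>\<phi> g\<close> comes for free, as the inverse of
  \<open>g\<close> acts as its two-sided inverse. The hypothesis \<open>ext\<close> is there because
  \<open>Bij\<close> contains only functions that are \<open>undefined\<close> off the
  carrier.\<close>

lemma representationI:
  assumes "group G" and "Module.module \<complex>\<^sub>F V"
    and lin: "\<And>g. g \<in> carrier G \<Longrightarrow> \<phi> g \<in> linear_maps V V"
    and ext: "\<And>g. g \<in> carrier G \<Longrightarrow> \<phi> g \<in> extensional (carrier V)"
    and one: "\<And>v. v \<in> carrier V \<Longrightarrow> \<phi> \<one>\<^bsub>G\<^esub> v = v"
    and mult: "\<And>g h v. \<lbrakk>g \<in> carrier G; h \<in> carrier G; v \<in> carrier V\<rbrakk> \<Longrightarrow>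
      \<phi> (g \<otimes>\<^bsub>G\<^esub> h) v = \<phi> g (\<phi> h v)"
  shows "representation G V \<phi>"
proof -
  interpret G: group G by fact
  have maps: "\<phi> g v \<in> carrier V" if "g \<in> carrier G" "v \<in> carrier V" for g v
    using lin[OF that(1)] that(2) by (auto simp: linear_maps_def)
  have Bij: "\<phi> g \<in> Bij (carrier V)" if g: "g \<in> carrier G" for g
  proof -
    have "bij_betw (\<phi> g) (carrier V) (carrier V)"
    proof (rule bij_betwI[where g = "\<phi> (inv\<^bsub>G\<^esub> g)"])
      show "\<phi> g \<in> carrier V \<rightarrow> carrier V" "\<phi> (inv\<^bsub>G\<^esub> g) \<in> carrier V \<rightarrow> carrier V"
        using g maps by auto
      show "\<phi> (inv\<^bsub>G\<^esub> g) (\<phi> g v) = v" if "v \<in> carrier V" for v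
        using g that by (simp add: mult[symmetric] one)
      show "\<phi> g (\<phi> (inv\<^bsub>G\<^esub> g) v) = v" if "v \<in> carrier V" for v
        using g that by (simp add: mult[symmetric] one)
    qed
    then show ?thesis
      using ext[OF g] by (simp add: Bij_def)
  qed
  \<comment> \<open>The product in \<open>BijGroup\<close> is composition restricted to the carrier.
    Both sides are extensional, so the pointwise law \<open>mult\<close> becomes an equality of
    functions.\<close>
  have "\<phi> (g \<otimes>\<^bsub>G\<^esub> h) = compose (carrier V) (\<phi> g) (\<phi> h)"
    if "g \<in> carrier G" "h \<in> carrier G" for g h
    using that by (intro extensionalityI[of _ "carrier V"] ext)
      (auto simp: compose_eq mult)
  then have "\<phi> \<in> hom G (BijGroup (carrier V))"
    by (auto simp: hom_def BijGroup_def Bij)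
  then have "group_action G (carrier V) \<phi>"
    by (intro group_action.intro group_hom.intro group_hom_axioms.intro group_BijGroup G.is_group)
  then show ?thesis
    using assms by (simp add: representation_def representation_axioms_def)
qed

section \<open>Direct sums of copies of a vector space\<close>

lemma copies_coord: "\<lbrakk>f \<in> carrier (copies_space n V); i < n\<rbrakk> \<Longrightarrow> f i \<in> carrier V"
  by (auto simp: copies_space_def)

text \<open>Families are \<open>undefined\<close> at indices from \<open>n\<close> on, so the
  coordinates below \<open>n\<close> decide equality. This reduces the axioms of the direct sum to
  those of \<open>V\<close>.\<close>

lemma copies_eqI:
  "\<lbrakk>f \<in> carrier (copies_space n V); h \<in> carrier (copies_space n V);
    \<And>i. i < n \<Longrightarrow> f i = h i\<rbrakk> \<Longrightarrow> f = h"
  by (intro PiE_ext[of f "{..<n}" "\<lambda>_. carrier V" h]) (auto simp: copies_space_def)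

lemma copies_apply:
  assumes "i < n"
  shows "\<zero>\<^bsub>copies_space n V\<^esub> i = \<zero>\<^bsub>V\<^esub>"
    and "(f \<oplus>\<^bsub>copies_space n V\<^esub> h) i = f i \<oplus>\<^bsub>V\<^esub> h i"
    and "(c \<odot>\<^bsub>copies_space n V\<^esub> f) i = c \<odot>\<^bsub>V\<^esub> f i"
  using assms by (simp_all add: copies_space_def)

lemma module_copies:
  assumes "Module.module \<complex>\<^sub>F V"
  shows "Module.module \<complex>\<^sub>F (copies_space n V)"
proof -
  interpret V: Module.module "\<complex>\<^sub>F" V by fact
  let ?W = "copies_space n V"
  have zero: "\<zero>\<^bsub>?W\<^esub> \<in> carrier ?W"
    and add: "\<lbrakk>f \<in> carrier ?W; h \<in> carrier ?W\<rbrakk> \<Longrightarrow> f \<oplus>\<^bsub>?W\<^esub> h \<in> carrier ?W"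
    and smult: "f \<in> carrier ?W \<Longrightarrow> c \<odot>\<^bsub>?W\<^esub> f \<in> carrier ?W" for c f h
    using copies_coord[of f] copies_coord[of h] V.smult_closed[of c]
    by (simp_all add: copies_space_def ring_of_type_algebra_def)
  note closed = zero add smult copies_coord
  show ?thesis
  proof (rule Module.moduleI)
    show "cring \<complex>\<^sub>F" by (rule cring_from_type_algebra)
    show "abelian_group ?W"
    proof (rule abelian_groupI)
      fix f assume f: "f \<in> carrier ?W"
      have neg: "(\<lambda>i\<in>{..<n}. \<ominus>\<^bsub>V\<^esub> f i) \<in> carrier ?W"
        using copies_coord[OF f] by (simp add: copies_space_def)
      then have "(\<lambda>i\<in>{..<n}. \<ominus>\<^bsub>V\<^esub> f i) \<oplus>\<^bsub>?W\<^esub> f = \<zero>\<^bsub>?W\<^esub>"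
        using f by (intro copies_eqI[where n = n and V = V]) (simp_all add: closed copies_apply V.l_neg)
      with neg show "\<exists>h\<in>carrier ?W. h \<oplus>\<^bsub>?W\<^esub> f = \<zero>\<^bsub>?W\<^esub>"
        by blast
      show "\<zero>\<^bsub>?W\<^esub> \<oplus>\<^bsub>?W\<^esub> f = f"
        using f by (intro copies_eqI[where n = n and V = V]) (simp_all add: closed copies_apply)
    next
      fix f h assume "f \<in> carrier ?W" "h \<in> carrier ?W"
      then show "f \<oplus>\<^bsub>?W\<^esub> h = h \<oplus>\<^bsub>?W\<^esub> f"
        by (intro copies_eqI[where n = n and V = V]) (simp_all add: closed copies_apply V.a_comm)
    next
      fix f h k assume "f \<in> carrier ?W" "h \<in> carrier ?W" "k \<in> carrier ?W"
      then show "(f \<oplus>\<^bsub>?W\<^esub> h) \<oplus>\<^bsub>?W\<^esub> k = f \<oplus>\<^bsub>?W\<^esub> (h \<oplus>\<^bsub>?W\<^esub> k)"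
        by (intro copies_eqI[where n = n and V = V]) (simp_all add: closed copies_apply V.a_assoc)
    qed (simp_all add: closed)
  next
    fix a b f
    assume "a \<in> carrier \<complex>\<^sub>F" "b \<in> carrier \<complex>\<^sub>F" "f \<in> carrier ?W"
    then show "(a \<oplus>\<^bsub>\<complex>\<^sub>F\<^esub> b) \<odot>\<^bsub>?W\<^esub> f = a \<odot>\<^bsub>?W\<^esub> f \<oplus>\<^bsub>?W\<^esub> b \<odot>\<^bsub>?W\<^esub> f"
      "(a \<otimes>\<^bsub>\<complex>\<^sub>F\<^esub> b) \<odot>\<^bsub>?W\<^esub> f = a \<odot>\<^bsub>?W\<^esub> (b \<odot>\<^bsub>?W\<^esub> f)"
      by (intro copies_eqI[where n = n and V = V]; simp add: closed copies_apply V.smult_l_distr V.smult_assoc1)+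
  next
    fix a f h assume "a \<in> carrier \<complex>\<^sub>F" "f \<in> carrier ?W" "h \<in> carrier ?W"
    then show "a \<odot>\<^bsub>?W\<^esub> (f \<oplus>\<^bsub>?W\<^esub> h) = a \<odot>\<^bsub>?W\<^esub> f \<oplus>\<^bsub>?W\<^esub> a \<odot>\<^bsub>?W\<^esub> h"
      by (intro copies_eqI[where n = n and V = V]) (simp_all add: closed copies_apply V.smult_r_distr)
  next
    fix f assume "f \<in> carrier ?W"
    then show "\<one>\<^bsub>\<complex>\<^sub>F\<^esub> \<odot>\<^bsub>?W\<^esub> f = f"
      by (intro copies_eqI[where n = n and V = V]) (simp_all add: closed copies_apply)
  qed (simp add: closed)
qed

section \<open>Pullbacks and direct sums of representations\<close>

context representation
begin

lemma action_closed: "\<lbrakk>g \<in> carrier G; v \<in> carrier V\<rbrakk> \<Longrightarrow> \<phi> g v \<in> carrier V"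
  using linear[of g] by (auto simp: linear_maps_def)

lemma action_add:
  "\<lbrakk>g \<in> carrier G; v \<in> carrier V; w \<in> carrier V\<rbrakk> \<Longrightarrow> \<phi> g (v \<oplus>\<^bsub>V\<^esub> w) = \<phi> g v \<oplus>\<^bsub>V\<^esub> \<phi> g w"
  using linear by (auto simp: linear_maps_def)

lemma action_smult:
  "\<lbrakk>g \<in> carrier G; v \<in> carrier V\<rbrakk> \<Longrightarrow> \<phi> g (c \<odot>\<^bsub>V\<^esub> v) = c \<odot>\<^bsub>V\<^esub> \<phi> g v"
  using linear by (auto simp: linear_maps_def)

lemma action_one: "v \<in> carrier V \<Longrightarrow> \<phi> \<one>\<^bsub>G\<^esub> v = v"
  using id_eq_one by (metis restrict_apply')

lemma action_mult:
  "\<lbrakk>g \<in> carrier G; h \<in> carrier G; v \<in> carrier V\<rbrakk> \<Longrightarrow> \<phi> (g \<otimes>\<^bsub>G\<^esub> h) v = \<phi> g (\<phi> h v)"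
  using composition_rule by blast

lemma action_extensional: "g \<in> carrier G \<Longrightarrow> \<phi> g \<in> extensional (carrier V)"
  using group_hom.hom_closed[OF group_hom, of g] by (simp add: BijGroup_def Bij_def)

text \<open>Restriction to a subgroup, taken along a homomorphism; it is what makes
  \<open>\<beta>\<^sub>\<phi>\<close> and \<open>\<rho>\<^sub>\<phi>\<close>
  representations.\<close>

lemma pullback:
  assumes "group_hom H G f"
  shows "representation H V (\<lambda>x. \<phi> (f x))"
proof -
  interpret f: group_hom H G f by fact
  show ?thesis
    using f.G.is_group V.module_axioms
    by (rule representationI) (simp_all add: linear action_extensional action_one action_mult)
qed

lemma representation_copies: "representation G (copies_space n V) (copies_action n V \<phi>)"
proof -
  let ?W = "copies_space n V"
  have closed: "copies_action n V \<phi> g f \<in> carrier ?W" if "g \<in> carrier G" "f \<in> carrier ?W" for g f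
    using that copies_coord[OF that(2)] action_closed
    by (simp add: copies_action_def) (simp add: copies_space_def)
  have coords: "copies_action n V \<phi> g f i = \<phi> g (f i)" if "f \<in> carrier ?W" "i < n" for g f i
    using that by (simp add: copies_action_def)
  have G: "group G" by (rule group_hom.axioms(1)[OF group_hom])
  have W: "Module.module \<complex>\<^sub>F ?W" by (rule module_copies) (rule V.module_axioms)
  have add: "f \<oplus>\<^bsub>?W\<^esub> h \<in> carrier ?W" if "f \<in> carrier ?W" "h \<in> carrier ?W" for f h
    using that by (rule abelian_groupE(1)[OF module.axioms(2)[OF W]])
  have smult: "c \<odot>\<^bsub>?W\<^esub> f \<in> carrier ?W" if "f \<in> carrier ?W" for c f
    using that by (intro module.smult_closed[OF W]) (simp_all add: ring_of_type_algebra_def)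
  show ?thesis
  proof (rule representationI)
    fix g assume g: "g \<in> carrier G"
    show "copies_action n V \<phi> g \<in> extensional (carrier ?W)"
      by (simp add: copies_action_def)
    show "copies_action n V \<phi> g \<in> linear_maps ?W ?W"
      unfolding linear_maps_def mem_Collect_eq
    proof (intro conjI funcsetI ballI allI)
      fix f h assume "f \<in> carrier ?W" "h \<in> carrier ?W"
      with g show "copies_action n V \<phi> g (f \<oplus>\<^bsub>?W\<^esub> h) =
          copies_action n V \<phi> g f \<oplus>\<^bsub>?W\<^esub> copies_action n V \<phi> g h"
        by (intro copies_eqI[where n = n and V = V] add closed)
          (simp_all add: add closed coords copies_apply action_add copies_coord)
    next
      fix c f assume "f \<in> carrier ?W"
      with g show "copies_action n V \<phi> g (c \<odot>\<^bsub>?W\<^esub> f) = c \<odot>\<^bsub>?W\<^esub> copies_action n V \<phi> g f"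
        by (intro copies_eqI[where n = n and V = V] smult closed)
          (simp_all add: smult closed coords copies_apply action_smult copies_coord)
    qed (rule closed[OF g])
  next
    fix f assume f: "f \<in> carrier ?W"
    show "copies_action n V \<phi> \<one>\<^bsub>G\<^esub> f = f"
      using f monoid.one_closed[OF group.is_monoid[OF G]]
      by (intro copies_eqI[where n = n and V = V]) (simp_all add: closed coords action_one copies_coord)
  next
    fix g h f assume g: "g \<in> carrier G" and h: "h \<in> carrier G" and f: "f \<in> carrier ?W"
    show "copies_action n V \<phi> (g \<otimes>\<^bsub>G\<^esub> h) f = copies_action n V \<phi> g (copies_action n V \<phi> h f)"
      using f g h monoid.m_closed[OF group.is_monoid[OF G]]
      by (intro copies_eqI[where n = n and V = V]) (simp_all add: closed coords action_mult copies_coord)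
  qed (use G W in auto)
qed

end

section \<open>The regular representation\<close>

lemma module_group_algebra: "Module.module \<complex>\<^sub>F (group_algebra G)"
proof (rule Module.moduleI)
  show "cring \<complex>\<^sub>F" by (rule cring_from_type_algebra)
  show "abelian_group (group_algebra G)"
  proof (rule abelian_groupI)
    fix f assume f: "f \<in> carrier (group_algebra G)"
    then have "(\<lambda>x\<in>carrier G. - f x) \<in> carrier (group_algebra G)"
      "(\<lambda>x\<in>carrier G. - f x) \<oplus>\<^bsub>group_algebra G\<^esub> f = \<zero>\<^bsub>group_algebra G\<^esub>"
      by (auto simp: group_algebra_def intro!: restrict_ext)
    then show "\<exists>h\<in>carrier (group_algebra G). h \<oplus>\<^bsub>group_algebra G\<^esub> f = \<zero>\<^bsub>group_algebra G\<^esub>"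
      by blast
  qed (auto simp: group_algebra_def PiE_iff fun_eq_iff extensional_def)
qed (auto simp: group_algebra_def ring_of_type_algebra_def PiE_iff fun_eq_iff extensional_def
    algebra_simps)

text \<open>In the convolution of \<open>group_elem G g\<close> with \<open>f\<close> only the
  summand at \<open>g\<close> survives. Multiplying the formal sum by \<open>g\<close> moves the
  coefficient of \<open>y\<close> to the element \<open>gy\<close>, so the new coefficient at
  \<open>x\<close> is the old one at \<open>g^-1 x\<close>. From here on the regular representation
  is handled as this translation.\<close>

lemma regular_rep_apply:
  assumes "finite (carrier G)" "g \<in> carrier G" "f \<in> carrier (group_algebra G)"
  shows "regular_rep G g f = (\<lambda>x\<in>carrier G. f (inv\<^bsub>G\<^esub> g \<otimes>\<^bsub>G\<^esub> x))"
proof -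
  have "(\<Sum>y\<in>carrier G. group_elem G g y * f (inv\<^bsub>G\<^esub> y \<otimes>\<^bsub>G\<^esub> x)) = f (inv\<^bsub>G\<^esub> g \<otimes>\<^bsub>G\<^esub> x)" for x
  proof -
    have "(\<Sum>y\<in>carrier G. group_elem G g y * f (inv\<^bsub>G\<^esub> y \<otimes>\<^bsub>G\<^esub> x)) =
        (\<Sum>y\<in>carrier G. if y = g then f (inv\<^bsub>G\<^esub> y \<otimes>\<^bsub>G\<^esub> x) else 0)"
      by (intro sum.cong) (auto simp: group_elem_def)
    also have "\<dots> = f (inv\<^bsub>G\<^esub> g \<otimes>\<^bsub>G\<^esub> x)"
      using assms by simp
    finally show ?thesis .
  qed
  then show ?thesis
    using assms by (simp add: regular_rep_def group_algebra_def)
qed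

text \<open>Translation by inverses gives a left action: \<open>f\<close> is evaluated at
  \<open>h^-1 (g^-1 x) = (gh)^-1 x\<close>.\<close>

lemma representation_regular:
  assumes "group G" and fin: "finite (carrier G)"
  shows "representation G (group_algebra G) (regular_rep G)"
proof (rule representationI)
  interpret group G by fact
  show "group G" by fact
  show "Module.module \<complex>\<^sub>F (group_algebra G)" by (rule module_group_algebra)
  have closed: "(\<lambda>x\<in>carrier G. u x) \<in> carrier (group_algebra G)" for u
    by (auto simp: group_algebra_def)
  have add: "f \<oplus>\<^bsub>group_algebra G\<^esub> h \<in> carrier (group_algebra G)"
    and smult: "c \<odot>\<^bsub>group_algebra G\<^esub> f \<in> carrier (group_algebra G)" for c f h
    by (auto simp: group_algebra_def)
  fix g assume g: "g \<in> carrier G"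
  show "regular_rep G g \<in> extensional (carrier (group_algebra G))"
    by (simp add: regular_rep_def)
  show "regular_rep G g \<in> linear_maps (group_algebra G) (group_algebra G)"
    using g add smult by (auto simp: linear_maps_def regular_rep_apply[OF fin] closed)
      (auto simp: group_algebra_def intro!: restrict_ext)
next
  interpret group G by fact
  fix f assume "f \<in> carrier (group_algebra G)"
  then show "regular_rep G \<one>\<^bsub>G\<^esub> f = f"
    by (simp add: regular_rep_apply[OF fin])
      (auto simp: group_algebra_def PiE_iff fun_eq_iff extensional_def)
next
  interpret group G by fact
  have closed: "(\<lambda>x\<in>carrier G. u x) \<in> carrier (group_algebra G)" for u
    by (auto simp: group_algebra_def)
  fix g h f assume "g \<in> carrier G" "h \<in> carrier G" "f \<in> carrier (group_algebra G)"
  then show "regular_rep G (g \<otimes>\<^bsub>G\<^esub> h) f = regular_rep G g (regular_rep G h f)"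
    by (auto simp: regular_rep_apply[OF fin] closed inv_mult_group m_assoc intro!: restrict_ext)
qed

text \<open>The family \<open>r\<close> is a right transversal of the image of \<open>h\<close>: a function on \<open>L\<close> is the family of
  its restrictions to the right cosets of that image, each of them identified with \<open>G\<close>.\<close>

lemma regular_rep_restriction:
  assumes hom: "group_hom G L h" and fin: "finite (carrier L)" "finite (carrier G)"
    and r: "\<And>i. i < n \<Longrightarrow> r i \<in> carrier L"
    and bij: "bij_betw (\<lambda>(x, i). h x \<otimes>\<^bsub>L\<^esub> r i) (carrier G \<times> {..<n}) (carrier L)"
  shows "equivalent_representations G (group_algebra L) (\<lambda>x. regular_rep L (h x))
    (copies_space n (group_algebra G)) (copies_action n (group_algebra G) (regular_rep G))"
proof -
  interpret h: group_hom G L h by fact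
  \<comment> \<open>\<open>T\<close> records the values of \<open>f\<close> on each coset
    \<open>h(G) r_i\<close>, read through the parametrization by \<open>G\<close>. The map
    \<open>q\<close> sends \<open>y\<close> to the unique pair \<open>(x, i)\<close> with
    \<open>y = h(x) r_i\<close>, and \<open>S\<close> uses it to glue a family back into one
    function on \<open>L\<close>.\<close>
  define T :: "('b \<Rightarrow> complex) \<Rightarrow> nat \<Rightarrow> 'a \<Rightarrow> complex"
    where "T f = (\<lambda>i\<in>{..<n}. \<lambda>x\<in>carrier G. f (h x \<otimes>\<^bsub>L\<^esub> r i))" for f
  define p where "p = (\<lambda>(x, i). h x \<otimes>\<^bsub>L\<^esub> r i)"
  define q where "q = inv_into (carrier G \<times> {..<n}) p"
  define S :: "(nat \<Rightarrow> 'a \<Rightarrow> complex) \<Rightarrow> 'b \<Rightarrow> complex"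
    where "S F = (\<lambda>y\<in>carrier L. F (snd (q y)) (fst (q y)))" for F
  have qp: "q (h x \<otimes>\<^bsub>L\<^esub> r i) = (x, i)" if "x \<in> carrier G" "i < n" for x i
  proof -
    have "q (p (x, i)) = (x, i)"
      unfolding q_def using bij that by (intro inv_into_f_f) (auto simp: p_def bij_betw_def)
    then show ?thesis by (simp add: p_def)
  qed
  have pq: "h (fst (q y)) \<otimes>\<^bsub>L\<^esub> r (snd (q y)) = y"
    "fst (q y) \<in> carrier G" "snd (q y) < n" if "y \<in> carrier L" for y
  proof -
    have im: "y \<in> p ` (carrier G \<times> {..<n})"
      using bij that by (auto simp: p_def bij_betw_def)
    have "p (q y) = y" "q y \<in> carrier G \<times> {..<n}"
      unfolding q_def using im by (auto intro: f_inv_into_f inv_into_into)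
    then show "h (fst (q y)) \<otimes>\<^bsub>L\<^esub> r (snd (q y)) = y" "fst (q y) \<in> carrier G" "snd (q y) < n"
      by (auto simp: p_def split_beta)
  qed
  have T_closed: "T f \<in> carrier (copies_space n (group_algebra G))" for f
    by (auto simp: T_def copies_space_def group_algebra_def)
  have bijT: "bij_betw T (carrier (group_algebra L)) (carrier (copies_space n (group_algebra G)))"
  proof (rule bij_betwI[where g = S])
    show "S \<in> carrier (copies_space n (group_algebra G)) \<rightarrow> carrier (group_algebra L)"
      by (auto simp: S_def group_algebra_def)
    show "S (T f) = f" if "f \<in> carrier (group_algebra L)" for f
      using that by (auto simp: S_def T_def pq group_algebra_def fun_eq_iff PiE_iff extensional_def)
    show "T (S F) = F" if F: "F \<in> carrier (copies_space n (group_algebra G))" for F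
    proof (intro ext)
      fix i x
      \<comment> \<open>Inside the ranges this is \<open>qp\<close>. For an index from
        \<open>n\<close> on, or \<open>x\<close> outside \<open>G\<close>, both sides have the
        default value, since \<open>F\<close> and its members are extensional.\<close>
      show "T (S F) i x = F i x"
        using F r by (cases "i < n"; cases "x \<in> carrier G")
          (auto simp: S_def T_def qp copies_space_def group_algebra_def PiE_iff extensional_def)
    qed
  qed (use T_closed in auto)
  have lin: "T \<in> linear_maps (group_algebra L) (copies_space n (group_algebra G))"
    using T_closed r
    by (auto simp: linear_maps_def)
      (auto simp: T_def copies_space_def group_algebra_def fun_eq_iff)
  \<comment> \<open>Left translation by \<open>h g\<close> preserves each right coset: both sides at
    \<open>(i, x)\<close> are the value of \<open>f\<close> at
    \<open>h(g)^-1 h(x) r_i = h(g^-1 x) r_i\<close>.\<close>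
  have "T (regular_rep L (h g) f) = copies_action n (group_algebra G) (regular_rep G) g (T f)"
    if g: "g \<in> carrier G" and f: "f \<in> carrier (group_algebra L)" for g f
  proof -
    have TG: "T f i \<in> carrier (group_algebra G)" if "i < n" for i
      using T_closed[of f] that by (auto simp: copies_space_def)
    have "T (regular_rep L (h g) f) i x =
        copies_action n (group_algebra G) (regular_rep G) g (T f) i x" for i x
    proof (cases "i < n \<and> x \<in> carrier G")
      case True
      then show ?thesis
        using g f r TG T_closed[of f]
        by (simp add: copies_action_def regular_rep_apply fin)
          (simp add: T_def h.H.m_assoc)
    next
      \<comment> \<open>Out of range, both sides are \<open>undefined\<close>: as a function if
        \<open>i\<close> is too large, as a number if only \<open>x\<close> lies outside
        \<open>G\<close>.\<close>
      case False
      then show ?thesis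
        using g TG T_closed[of f]
        by (cases "i < n") (auto simp: copies_action_def regular_rep_apply fin, simp_all add: T_def)
    qed
    then show ?thesis by blast
  qed
  moreover have "representation G (group_algebra L) (\<lambda>x. regular_rep L (h x))"
    by (intro representation.pullback[OF representation_regular] hom fin h.H.is_group)
  moreover have "representation G (copies_space n (group_algebra G))
      (copies_action n (group_algebra G) (regular_rep G))"
    by (intro representation.representation_copies representation_regular fin h.G.is_group)
  ultimately show ?thesis
    unfolding equivalent_representations_def using bijT lin by blast
qed

section \<open>The semidirect product attached to a skew left brace\<close>

text \<open>\<open>groupI\<close> asks only for left inverses. That of \<open>(x, h)\<close> is
  \<open>(\<sigma>(h^-1)(x^-1), h^-1)\<close>, because \<open>\<sigma>(h^-1)\<close> is
  multiplicative and hence sends \<open>x^-1 x\<close> to the identity.\<close>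

lemma group_semidirect_product:
  assumes "group N" "group H"
    and closed: "\<And>h x. \<lbrakk>h \<in> carrier H; x \<in> carrier N\<rbrakk> \<Longrightarrow> \<sigma> h x \<in> carrier N"
    and distrib: "\<And>h x y. \<lbrakk>h \<in> carrier H; x \<in> carrier N; y \<in> carrier N\<rbrakk> \<Longrightarrow>
      \<sigma> h (x \<otimes>\<^bsub>N\<^esub> y) = \<sigma> h x \<otimes>\<^bsub>N\<^esub> \<sigma> h y"
    and mult: "\<And>h k x. \<lbrakk>h \<in> carrier H; k \<in> carrier H; x \<in> carrier N\<rbrakk> \<Longrightarrow>
      \<sigma> (h \<otimes>\<^bsub>H\<^esub> k) x = \<sigma> h (\<sigma> k x)"
    and one: "\<And>x. x \<in> carrier N \<Longrightarrow> \<sigma> \<one>\<^bsub>H\<^esub> x = x"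
  shows "group (semidirect_product N H \<sigma>)"
proof -
  interpret N: group N by fact
  interpret H: group H by fact
  show ?thesis
  proof (rule groupI)
    fix z assume "z \<in> carrier (semidirect_product N H \<sigma>)"
    then obtain x h where z: "z = (x, h)" "x \<in> carrier N" "h \<in> carrier H"
      by (auto simp: semidirect_product_def)
    \<comment> \<open>By \<open>distrib\<close> the image of the identity equals its own square, and
      cancelling one factor leaves the identity.\<close>
    then have "\<sigma> (inv\<^bsub>H\<^esub> h) \<one>\<^bsub>N\<^esub> = \<one>\<^bsub>N\<^esub>"
      using distrib[of "inv\<^bsub>H\<^esub> h" "\<one>\<^bsub>N\<^esub>" "\<one>\<^bsub>N\<^esub>"] closed[of "inv\<^bsub>H\<^esub> h" "\<one>\<^bsub>N\<^esub>"]
      by (simp add: N.l_cancel_one)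
    with z have "(\<sigma> (inv\<^bsub>H\<^esub> h) (inv\<^bsub>N\<^esub> x), inv\<^bsub>H\<^esub> h) \<in> carrier (semidirect_product N H \<sigma>)"
      "(\<sigma> (inv\<^bsub>H\<^esub> h) (inv\<^bsub>N\<^esub> x), inv\<^bsub>H\<^esub> h) \<otimes>\<^bsub>semidirect_product N H \<sigma>\<^esub> z =
        \<one>\<^bsub>semidirect_product N H \<sigma>\<^esub>"
      by (auto simp: semidirect_product_def closed distrib[symmetric])
    then show "\<exists>y\<in>carrier (semidirect_product N H \<sigma>).
        y \<otimes>\<^bsub>semidirect_product N H \<sigma>\<^esub> z = \<one>\<^bsub>semidirect_product N H \<sigma>\<^esub>"
      by blast
  qed (auto simp: semidirect_product_def closed distrib mult one N.m_assoc H.m_assoc)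
qed

section \<open>The action of the circle group on the dot group\<close>

context skew_left_brace
begin

lemma circ_closed: "\<lbrakk>a \<in> carrier A; b \<in> carrier A\<rbrakk> \<Longrightarrow> a \<otimes>\<^bsub>C\<^esub> b \<in> carrier A"
  using circ.m_closed same_carrier by simp

lemma one_eq: "\<one>\<^bsub>C\<^esub> = \<one>\<^bsub>A\<^esub>"
proof -
  let ?e = "\<one>\<^bsub>C\<^esub>"
  have e: "?e \<in> carrier A"
    using circ.one_closed same_carrier by simp
  \<comment> \<open>The brace law with \<open>a\<close> the circle identity and \<open>b\<close>,
    \<open>c\<close> the dot identity: the left side collapses to the dot identity, the right side
    to the dot inverse of \<open>?e\<close>.\<close>
  have "\<one>\<^bsub>A\<^esub> = inv\<^bsub>A\<^esub> ?e \<otimes>\<^bsub>A\<^esub> \<one>\<^bsub>A\<^esub>"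
    using brace_distrib[OF e dot.one_closed dot.one_closed] e
    by (simp add: same_carrier)
  then show ?thesis
    using e by (metis dot.inv_closed dot.inv_inv dot.inv_one dot.r_one)
qed

lemma lambda_closed:
  "\<lbrakk>a \<in> carrier A; b \<in> carrier A\<rbrakk> \<Longrightarrow> lambda_op A C a b \<in> carrier A"
  by (simp add: lambda_op_def circ_closed)

text \<open>This is the brace law multiplied by \<open>a^-1\<close> on the right and
  rebracketed.\<close>

lemma lambda_mult:
  "\<lbrakk>a \<in> carrier A; b \<in> carrier A; c \<in> carrier A\<rbrakk> \<Longrightarrow>
    lambda_op A C a (b \<otimes>\<^bsub>A\<^esub> c) = lambda_op A C a b \<otimes>\<^bsub>A\<^esub> lambda_op A C a c"
  by (simp add: lambda_op_def brace_distrib circ_closed dot.m_assoc)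

lemma lambda_one: "a \<in> carrier A \<Longrightarrow> lambda_op A C a \<one>\<^bsub>A\<^esub> = \<one>\<^bsub>A\<^esub>"
  by (simp add: lambda_op_def circ.r_one[of a, unfolded one_eq same_carrier])

lemma one_lambda: "b \<in> carrier A \<Longrightarrow> lambda_op A C \<one>\<^bsub>A\<^esub> b = b"
  by (simp add: lambda_op_def circ.l_one[of b, unfolded one_eq same_carrier])

text \<open>Write the circle product of \<open>a\<close> and \<open>x\<close> as
  \<open>\<lambda>_a(x) a\<close>. Expanding both bracketings of the circle product of
  \<open>a\<close>, \<open>b\<close>, \<open>c\<close> in this way, with \<open>lambda_mult\<close>
  for the second one, leaves the circle product of \<open>a\<close> and \<open>b\<close> as a common
  right factor, which cancels.\<close>

lemma circ_lambda:
  assumes "a \<in> carrier A" "b \<in> carrier A" "c \<in> carrier A"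
  shows "lambda_op A C (a \<otimes>\<^bsub>C\<^esub> b) c = lambda_op A C a (lambda_op A C b c)"
proof -
  have bc: "b \<otimes>\<^bsub>C\<^esub> c = lambda_op A C b c \<otimes>\<^bsub>A\<^esub> b"
    using assms by (simp add: lambda_op_def circ_closed dot.m_assoc)
  have circ: "a \<otimes>\<^bsub>C\<^esub> x = lambda_op A C a x \<otimes>\<^bsub>A\<^esub> a" if "x \<in> carrier A" for x
    using assms that by (simp add: lambda_op_def circ_closed dot.m_assoc)
  have "(a \<otimes>\<^bsub>C\<^esub> b) \<otimes>\<^bsub>C\<^esub> c = a \<otimes>\<^bsub>C\<^esub> (b \<otimes>\<^bsub>C\<^esub> c)"
    using assms by (simp add: circ.m_assoc same_carrier)
  also have "\<dots> = lambda_op A C a (lambda_op A C b c) \<otimes>\<^bsub>A\<^esub> (a \<otimes>\<^bsub>C\<^esub> b)"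
    using assms by (simp add: circ bc lambda_closed lambda_mult dot.m_assoc)
  finally show ?thesis
    using assms by (simp add: lambda_op_def[of A C "a \<otimes>\<^bsub>C\<^esub> b"] circ_closed lambda_closed
        dot.m_assoc)
qed

lemma group_Lambda_op: "group (Lambda_op A C)"
  unfolding Lambda_op_def
  by (rule group_semidirect_product)
    (auto simp: dot.is_group circ.is_group same_carrier lambda_closed lambda_mult circ_lambda
      one_eq one_lambda)

lemma carrier_Lambda_op: "carrier (Lambda_op A C) = carrier A \<times> carrier A"
  by (simp add: Lambda_op_def semidirect_product_def same_carrier)

lemma mult_Lambda_op:
  "(a, b) \<otimes>\<^bsub>Lambda_op A C\<^esub> (c, d) = (a \<otimes>\<^bsub>A\<^esub> lambda_op A C b c, b \<otimes>\<^bsub>C\<^esub> d)"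
  by (simp add: Lambda_op_def semidirect_product_def)

text \<open>The inverse map belongs to the circle inverse of \<open>a\<close>, by
  \<open>circ_lambda\<close> and \<open>one_lambda\<close>.\<close>

lemma bij_lambda:
  assumes "a \<in> carrier A"
  shows "bij_betw (lambda_op A C a) (carrier A) (carrier A)"
proof -
  have "inv\<^bsub>C\<^esub> a \<in> carrier A" "inv\<^bsub>C\<^esub> a \<otimes>\<^bsub>C\<^esub> a = \<one>\<^bsub>A\<^esub>" "a \<otimes>\<^bsub>C\<^esub> inv\<^bsub>C\<^esub> a = \<one>\<^bsub>A\<^esub>"
    using assms circ.inv_closed[of a] by (auto simp: same_carrier one_eq)
  with assms show ?thesis
    by (intro bij_betwI[where g = "lambda_op A C (inv\<^bsub>C\<^esub> a)"])
      (auto simp: lambda_closed circ_lambda[symmetric] one_lambda)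
qed

section \<open>The two embedded groups and their transversals\<close>

lemma hom_dot_Lambda_op: "group_hom A (Lambda_op A C) (\<lambda>a. (a, \<one>\<^bsub>C\<^esub>))"
  by (intro group_hom.intro group_hom_axioms.intro dot.is_group group_Lambda_op)
    (auto simp: hom_def carrier_Lambda_op mult_Lambda_op one_eq one_lambda
      circ.l_one[unfolded same_carrier one_eq])

lemma hom_circ_Lambda_op: "group_hom C (Lambda_op A C) (\<lambda>b. (\<one>\<^bsub>A\<^esub>, b))"
  by (intro group_hom.intro group_hom_axioms.intro circ.is_group group_Lambda_op)
    (auto simp: hom_def carrier_Lambda_op mult_Lambda_op same_carrier lambda_one)

text \<open>The circle identity acts trivially, so the product map is just \<open>id\<close> times
  the enumeration \<open>e\<close>.\<close>

lemma transversal_dot: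
  assumes "bij_betw e I (carrier A)"
  shows "bij_betw (\<lambda>(a, i). (a, \<one>\<^bsub>C\<^esub>) \<otimes>\<^bsub>Lambda_op A C\<^esub> (\<one>\<^bsub>A\<^esub>, e i))
    (carrier A \<times> I) (carrier (Lambda_op A C))"
proof -
  have "bij_betw (map_prod id e) (carrier A \<times> I) (carrier A \<times> carrier A)"
    using assms by (intro bij_betw_map_prod) auto
  moreover have "map_prod id e z = (case z of (a, i) \<Rightarrow> (a, \<one>\<^bsub>C\<^esub>) \<otimes>\<^bsub>Lambda_op A C\<^esub> (\<one>\<^bsub>A\<^esub>, e i))"
    if "z \<in> carrier A \<times> I" for z
    using that bij_betwE[OF assms] circ.l_one
    by (auto simp: mult_Lambda_op one_eq one_lambda same_carrier)
  ultimately show ?thesis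
    unfolding carrier_Lambda_op by (simp cong: bij_betw_cong)
qed

text \<open>The product is now twisted to \<open>(\<lambda>_b(e i), b)\<close>. The second
  coordinate recovers \<open>b\<close>, and over each fixed \<open>b\<close> the map from
  \<open>I\<close> to \<open>A\<close> is \<open>e\<close> followed by the bijection of
  \<open>bij_lambda\<close>.\<close>

lemma transversal_circ:
  assumes e: "bij_betw e I (carrier A)"
  shows "bij_betw (\<lambda>(b, i). (\<one>\<^bsub>A\<^esub>, b) \<otimes>\<^bsub>Lambda_op A C\<^esub> (e i, \<one>\<^bsub>C\<^esub>))
    (carrier C \<times> I) (carrier (Lambda_op A C))"
proof -
  have val: "(\<one>\<^bsub>A\<^esub>, b) \<otimes>\<^bsub>Lambda_op A C\<^esub> (e i, \<one>\<^bsub>C\<^esub>) = (lambda_op A C b (e i), b)"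
    if "b \<in> carrier A" "i \<in> I" for b i
    using that bij_betwE[OF e] by (simp add: mult_Lambda_op same_carrier lambda_closed)
  have "bij_betw (lambda_op A C b \<circ> e) I (carrier A)" if "b \<in> carrier A" for b
    using e bij_lambda[OF that] by (rule bij_betw_trans)
  then have inj: "inj_on (\<lambda>i. lambda_op A C b (e i)) I"
    and surj: "(\<lambda>i. lambda_op A C b (e i)) ` I = carrier A" if "b \<in> carrier A" for b
    using that by (auto simp: bij_betw_def comp_def)
  have "bij_betw (\<lambda>(b, i). (lambda_op A C b (e i), b)) (carrier A \<times> I) (carrier A \<times> carrier A)"
    unfolding bij_betw_def
  proof
    show "inj_on (\<lambda>(b, i). (lambda_op A C b (e i), b)) (carrier A \<times> I)"
      using inj by (auto simp: inj_on_def)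
    show "(\<lambda>(b, i). (lambda_op A C b (e i), b)) ` (carrier A \<times> I) = carrier A \<times> carrier A"
    proof (intro equalityI subsetI)
      fix y assume "y \<in> (\<lambda>(b, i). (lambda_op A C b (e i), b)) ` (carrier A \<times> I)"
      then show "y \<in> carrier A \<times> carrier A"
        using bij_betwE[OF e] by (auto simp: lambda_closed)
    next
      fix y assume "y \<in> carrier A \<times> carrier A"
      then obtain a b where y: "y = (a, b)" "a \<in> carrier A" "b \<in> carrier A" by blast
      then obtain i where "i \<in> I" "a = lambda_op A C b (e i)"
        using surj[of b] by blast
      with y show "y \<in> (\<lambda>(b, i). (lambda_op A C b (e i), b)) ` (carrier A \<times> I)"
        by (auto intro!: image_eqI[where x = "(b, i)"])
    qed
  qed
  then show ?thesis
    unfolding carrier_Lambda_op same_carrier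
    by (rule bij_betw_cong[THEN iffD1, rotated]) (auto simp: val)
qed

end

theorem theorem4p19:
  fixes A C :: "'a monoid"
    and \<phi> :: "'a \<times> 'a \<Rightarrow> ('a \<times> 'a \<Rightarrow> complex) \<Rightarrow> ('a \<times> 'a \<Rightarrow> complex)"
    and \<beta>\<^sub>\<phi> \<rho>\<^sub>\<phi> :: "'a \<Rightarrow> ('a \<times> 'a \<Rightarrow> complex) \<Rightarrow> ('a \<times> 'a \<Rightarrow> complex)"
  assumes brace: "skew_left_brace A C"
    and finite: "finite (carrier A)"
    and phi: "\<phi> = regular_rep (Lambda_op A C)"
    and beta: "\<beta>\<^sub>\<phi> = (\<lambda>a. \<phi> (a, \<one>\<^bsub>C\<^esub>))"
    and rho: "\<rho>\<^sub>\<phi> = (\<lambda>b. \<phi> (\<one>\<^bsub>A\<^esub>, b))"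
  shows "equivalent_representations A
           (group_algebra (Lambda_op A C)) \<beta>\<^sub>\<phi>
           (copies_space (card (carrier A)) (group_algebra A))
           (copies_action (card (carrier A)) (group_algebra A) (regular_rep A))
       \<and> equivalent_representations C
           (group_algebra (Lambda_op A C)) \<rho>\<^sub>\<phi>
           (copies_space (card (carrier A)) (group_algebra C))
           (copies_action (card (carrier A)) (group_algebra C) (regular_rep C))"
proof -
  interpret skew_left_brace A C by fact
  \<comment> \<open>One enumeration of the common carrier serves both halves: the pairs
    \<open>(\<one>, e i)\<close> represent the cosets of the dot group, the pairs
    \<open>(e i, \<one>)\<close> those of the circle group. Hence the multiplicity is
    \<open>card (carrier A)\<close> both times.\<close>
  obtain e where e: "bij_betw e {..<card (carrier A)} (carrier A)"
    using ex_bij_betw_nat_finite[OF finite] by (auto simp: atLeast0LessThan)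
  note e_closed = bij_betwE[OF e]
  have fin: "finite (carrier (Lambda_op A C))" "finite (carrier C)"
    by (simp_all add: carrier_Lambda_op same_carrier finite)
  have "equivalent_representations A (group_algebra (Lambda_op A C))
      (\<lambda>a. regular_rep (Lambda_op A C) (a, \<one>\<^bsub>C\<^esub>))
      (copies_space (card (carrier A)) (group_algebra A))
      (copies_action (card (carrier A)) (group_algebra A) (regular_rep A))"
    using e_closed
    by (intro regular_rep_restriction[OF hom_dot_Lambda_op fin(1) finite _ transversal_dot[OF e]])
      (simp add: carrier_Lambda_op)
  moreover have "equivalent_representations C (group_algebra (Lambda_op A C))
      (\<lambda>b. regular_rep (Lambda_op A C) (\<one>\<^bsub>A\<^esub>, b))
      (copies_space (card (carrier A)) (group_algebra C))
      (copies_action (card (carrier A)) (group_algebra C) (regular_rep C))"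
    using e_closed
    by (intro regular_rep_restriction[OF hom_circ_Lambda_op fin _ transversal_circ[OF e]])
      (simp add: carrier_Lambda_op one_eq)
  ultimately show ?thesis
    by (simp add: phi beta rho)
qed

end
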